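(* Let $N\ge 1$ and $n\ge 1$ be integers. Then $$ CC_{N,n}=\Pi(n)\sum_{k=1}^{n}\binom{n+1}{k+1}\frac{(-1)^{N k}(-L_N)^k\,\Pi(k)}{\Pi(n+k r^N)}\left[ {n+k r^N}\atop{k}\right]_{C,\ge N}. $$
   Context: Let $r$ be a power of a prime, $T$ an indeterminate and $K=\mathbb F_r(T)$. For $i\ge 1$ put $[i]=T^{r^i}-T$, $D_i=[i][i-1]^r\cdots[1]^{r^{i-1}}$ and $L_i=[i][i-1]\cdots[1]$, with $D_0=L_0=1$. The Carlitz logarithm is $\log_C(x)=\sum_{i=0}^\infty(-1)^i x^{r^i}/L_i\in K[[x]]$, and its partial sums are $\mathcal F_m(x)=\sum_{i=0}^m(-1)^i x^{r^i}/L_i$ (with $\mathcal F_{-1}=0$). For a non-negative integer $i$ with base-$r$ expansion $i=\sum_{j=0}^m c_j r^j$ ($0\le c_j<r$), the Carlitz factorial is $\Pi(i)=\prod_{j=0}^m D_j^{c_j}$. For $N\ge 1$, the truncated Cauchy-Carlitz numbers $CC_{N,n}$ are defined by $$ \frac{(-1)^N x^{r^N}/L_N}{\log_C(x)-\sum_{i=0}^{N-1}(-1)^i x^{r^i}/L_i}=\sum_{n=0}^\infty\frac{CC_{N,n}}{\Pi(n)}x^n . $$ The associated Stirling-Carlitz numbers of the first kind $\left[ {n}\atop{k}\right]_{C,\ge m}$ are defined by $$ \frac{\bigl(\log_C(z)-\mathcal F_{m-1}(z)\bigr)^k}{\Pi(k)}=\sum_{n=0}^\infty\left[ {n}\atop{k}\right]_{C,\ge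 m}\frac{z^n}{\Pi(n)} . $$ Binomial coefficients are ordinary integers viewed in $K$. *)

theory Defs
  imports
    "HOL-Computational_Algebra.Computational_Algebra"
    "HOL-Library.Cardinality"
begin

text \<open>
  A type \<open>'a :: finite_field\<close> with \<open>r = CARD('a)\<close> elements plays the role of the field with \<open>r\<close>
  elements, so that \<open>'a poly fract\<close> is the rational function field \<open>K\<close>.
\<close>

definition carlitz_T :: "'a :: finite_field poly fract" where
  "carlitz_T = to_fract [:0, 1:]"

definition carlitz_bracket :: "nat \<Rightarrow> 'a :: finite_field poly fract" where
  "carlitz_bracket i = carlitz_T ^ (CARD('a) ^ i) - carlitz_T"

definition carlitz_D :: "nat \<Rightarrow> 'a :: finite_field poly fract" where
  "carlitz_D i = (\<Prod>j<i. carlitz_bracket (i - j) ^ (CARD('a) ^ j))"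

definition carlitz_L :: "nat \<Rightarrow> 'a :: finite_field poly fract" where
  "carlitz_L i = (\<Prod>j=1..i. carlitz_bracket j)"

text \<open>
  The \<open>j\<close>-th base-\<open>r\<close> digit of \<open>n\<close> is \<open>n div r ^ j mod r\<close>; it vanishes for \<open>j > n\<close>, so the
  product below runs over all nonzero digits.
\<close>

definition carlitz_factorial :: "nat \<Rightarrow> 'a :: finite_field poly fract" where
  "carlitz_factorial n = (\<Prod>j\<le>n. carlitz_D j ^ (n div CARD('a) ^ j mod CARD('a)))"

definition carlitz_log_term :: "nat \<Rightarrow> 'a :: finite_field poly fract fps" where
  "carlitz_log_term i = fps_const ((- 1) ^ i / carlitz_L i) * fps_X ^ (CARD('a) ^ i)"

text \<open>The infinite sum is taken in the usual topology of formal power series.\<close>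

definition carlitz_log :: "'a :: finite_field poly fract fps" where
  "carlitz_log = (\<Sum>i. carlitz_log_term i)"

text \<open>
  Indices are shifted by one to include the empty sum: \<open>carlitz_log_partial m\<close> is the partial sum
  of the terms \<open>0, \<dots>, m - 1\<close>, conventionally denoted by \<open>F\<close> with index \<open>m - 1\<close>.
\<close>

definition carlitz_log_partial :: "nat \<Rightarrow> 'a :: finite_field poly fract fps" where
  "carlitz_log_partial m = (\<Sum>i<m. carlitz_log_term i)"

text \<open>
  Numbers defined by a generating function \<open>f = (\<Sum>n. (a n / \<Pi> n) x ^ n)\<close> are given
  explicitly as \<open>a n = \<Pi> n * fps_nth f n\<close>. The generating functions themselves are recovered
  in the lemmas \<open>truncated_cauchy_carlitz_gf\<close> and \<open>stirling_carlitz1_gf\<close> below.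
\<close>

definition truncated_cauchy_carlitz :: "nat \<Rightarrow> nat \<Rightarrow> 'a :: finite_field poly fract" where
  "truncated_cauchy_carlitz N n =
     carlitz_factorial n *
     fps_nth (fps_const ((- 1) ^ N / carlitz_L N) * fps_X ^ (CARD('a) ^ N) /
              (carlitz_log - (\<Sum>i<N. fps_const ((- 1) ^ i / carlitz_L i) * fps_X ^ (CARD('a) ^ i)))) n"

text \<open>\<open>stirling_carlitz1 m n k\<close> has \<open>n\<close> on top, \<open>k\<close> at the bottom and subscript \<open>\<ge> m\<close>.\<close>

definition stirling_carlitz1 :: "nat \<Rightarrow> nat \<Rightarrow> nat \<Rightarrow> 'a :: finite_field poly fract" where
  "stirling_carlitz1 m n k =
     carlitz_factorial n *
     fps_nth ((carlitz_log - carlitz_log_partial m) ^ k / fps_const (carlitz_factorial k)) n"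

lemma CARD_gt_1: "CARD('a :: finite_field) > 1"
proof -
  have "card {0, 1 :: 'a} \<le> CARD('a)"
    by (rule card_mono) auto
  thus ?thesis by simp
qed

lemma carlitz_bracket_nonzero:
  assumes "i \<ge> 1"
  shows "(carlitz_bracket i :: 'a :: finite_field poly fract) \<noteq> 0"
proof -
  let ?m = "CARD('a) ^ i"
  have m: "?m > 1"
    using CARD_gt_1[where 'a = 'a] assms one_less_power[of "CARD('a)" i] by simp
  have power: "to_fract (p :: 'a poly) ^ k = to_fract (p ^ k)" for p k
    by (induction k) auto
  have "degree ([:0, 1:] ^ ?m :: 'a poly) = ?m"
    by (simp add: degree_power_eq)
  moreover have "degree ([:0, 1:] :: 'a poly) = 1"
    by simp
  ultimately have "[:0, 1:] ^ ?m \<noteq> ([:0, 1:] :: 'a poly)"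
    using m by fastforce
  thus ?thesis
    unfolding carlitz_bracket_def carlitz_T_def power by simp
qed

lemma carlitz_L_nonzero: "(carlitz_L i :: 'a :: finite_field poly fract) \<noteq> 0"
  unfolding carlitz_L_def by (simp add: carlitz_bracket_nonzero)

lemma carlitz_D_nonzero: "(carlitz_D i :: 'a :: finite_field poly fract) \<noteq> 0"
  unfolding carlitz_D_def by (simp add: carlitz_bracket_nonzero)

lemma carlitz_factorial_nonzero: "(carlitz_factorial n :: 'a :: finite_field poly fract) \<noteq> 0"
  unfolding carlitz_factorial_def by (simp add: carlitz_D_nonzero)

lemma carlitz_log_term_nth:
  "fps_nth (carlitz_log_term i :: 'a :: finite_field poly fract fps) n =
     (if n = CARD('a) ^ i then (- 1) ^ i / carlitz_L i else 0)"
  by (simp add: carlitz_log_term_def)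

lemma carlitz_log_sums: "carlitz_log_term sums (carlitz_log :: 'a :: finite_field poly fract fps)"
proof -
  let ?r = "CARD('a)"
  define f :: "'a poly fract fps"
    where "f = Abs_fps (\<lambda>n. fps_nth (\<Sum>i\<le>n. carlitz_log_term i) n)"
  have "(\<lambda>m. \<Sum>i<m. carlitz_log_term i) \<longlonglongrightarrow> f"
  proof (rule tendsto_fpsI)
    fix n
    show "\<forall>\<^sub>F m in sequentially. fps_nth (\<Sum>i<m. carlitz_log_term i) n = fps_nth f n"
      using eventually_gt_at_top[of n]
    proof eventually_elim
      case (elim m)
      have "(\<Sum>i\<le>n. fps_nth (carlitz_log_term i :: 'a poly fract fps) n) =
            (\<Sum>i<m. fps_nth (carlitz_log_term i) n)"
      proof (rule sum.mono_neutral_left)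
        show "\<forall>i\<in>{..<m} - {..n}. fps_nth (carlitz_log_term i :: 'a poly fract fps) n = 0"
        proof
          fix i assume "i \<in> {..<m} - {..n}"
          hence "n < i" by auto
          also have "i < ?r ^ i"
            by (rule power_gt_expt) (use CARD_gt_1[where 'a = 'a] in simp)
          finally show "fps_nth (carlitz_log_term i :: 'a poly fract fps) n = 0"
            by (simp add: carlitz_log_term_nth)
        qed
      qed (use elim in auto)
      thus ?case by (simp add: f_def fps_sum_nth)
    qed
  qed
  hence "carlitz_log_term sums f" by (simp add: sums_def)
  thus ?thesis unfolding carlitz_log_def using sums_summable summable_sums by blast
qed

lemma carlitz_log_nth_power:
  "fps_nth (carlitz_log :: 'a :: finite_field poly fract fps) (CARD('a) ^ N) = (- 1) ^ N / carlitz_L N"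
  "(\<And>N. n \<noteq> CARD('a) ^ N) \<Longrightarrow> fps_nth (carlitz_log :: 'a poly fract fps) n = 0"
proof -
  let ?r = "CARD('a)"
  have ev: "\<forall>\<^sub>F m in sequentially.
      fps_nth (\<Sum>i<m. carlitz_log_term i) n = fps_nth (carlitz_log :: 'a poly fract fps) n" for n
    using carlitz_log_sums[where 'a = 'a] unfolding sums_def tendsto_fps_iff by blast
  {
    have "\<forall>\<^sub>F m in sequentially. fps_nth (carlitz_log :: 'a poly fract fps) (?r ^ N) = (- 1) ^ N / carlitz_L N"
      using ev[of "?r ^ N"] eventually_gt_at_top[of N]
    proof eventually_elim
      case (elim m)
      have "?r ^ N = ?r ^ i \<longleftrightarrow> N = i" for i
        using CARD_gt_1[where 'a = 'a] by (simp add: power_inject_exp)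
      with elim show ?case
        by (simp add: fps_sum_nth carlitz_log_term_nth sum.delta)
    qed
    thus "fps_nth (carlitz_log :: 'a poly fract fps) (?r ^ N) = (- 1) ^ N / carlitz_L N"
      by simp
  }
  {
    assume "\<And>N. n \<noteq> CARD('a) ^ N"
    hence "\<forall>\<^sub>F m in sequentially. fps_nth (carlitz_log :: 'a poly fract fps) n = 0"
      using ev[of n] by (auto elim!: eventually_mono simp: fps_sum_nth carlitz_log_term_nth)
    thus "fps_nth (carlitz_log :: 'a poly fract fps) n = 0" by simp
  }
qed

lemma carlitz_log_tail_nth:
  "fps_nth (carlitz_log - carlitz_log_partial N :: 'a :: finite_field poly fract fps) n =
     (if \<exists>i\<ge>N. n = CARD('a) ^ i then fps_nth carlitz_log n else 0)"
proof (cases "\<exists>i. n = CARD('a) ^ i")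
  case True
  then obtain i where i: "n = CARD('a) ^ i" by blast
  have "CARD('a) ^ i = CARD('a) ^ j \<longleftrightarrow> i = j" for j
    using CARD_gt_1[where 'a = 'a] by (simp add: power_inject_exp)
  thus ?thesis
    by (auto simp: i carlitz_log_partial_def fps_sum_nth carlitz_log_term_nth
        carlitz_log_nth_power(1) sum.delta)
next
  case False
  thus ?thesis
    by (auto simp: carlitz_log_partial_def fps_sum_nth carlitz_log_term_nth carlitz_log_nth_power(2))
qed

lemma carlitz_log_tail_subdegree:
  "subdegree (carlitz_log - carlitz_log_partial N :: 'a :: finite_field poly fract fps) = CARD('a) ^ N"
proof (rule subdegreeI)
  show "fps_nth (carlitz_log - carlitz_log_partial N :: 'a poly fract fps) (CARD('a) ^ N) \<noteq> 0"
    unfolding carlitz_log_tail_nth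
    by (auto simp: carlitz_log_nth_power(1) carlitz_L_nonzero)
next
  fix j assume j: "j < CARD('a) ^ N"
  have "\<not> (\<exists>i\<ge>N. j = CARD('a) ^ i)"
    using j CARD_gt_1[where 'a = 'a] by (auto simp: power_increasing_iff simp flip: not_le)
  thus "fps_nth (carlitz_log - carlitz_log_partial N :: 'a poly fract fps) j = 0"
    unfolding carlitz_log_tail_nth by (simp only: if_False)
qed

text \<open>
  The quotient defining the truncated Cauchy-Carlitz numbers is an exact one: multiplying it by the
  denominator gives back the numerator.
\<close>

lemma truncated_cauchy_carlitz_gf:
  "Abs_fps (\<lambda>n. truncated_cauchy_carlitz N n / carlitz_factorial n) *
     (carlitz_log - (\<Sum>i<N. fps_const ((- 1) ^ i / carlitz_L i) * fps_X ^ (CARD('a) ^ i))) =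
   (fps_const ((- 1) ^ N / carlitz_L N) * fps_X ^ (CARD('a) ^ N) :: 'a :: finite_field poly fract fps)"
proof -
  let ?f = "fps_const ((- 1) ^ N / carlitz_L N) * fps_X ^ (CARD('a) ^ N) :: 'a poly fract fps"
  let ?g = "carlitz_log - carlitz_log_partial N :: 'a poly fract fps"
  have "subdegree ?f = CARD('a) ^ N"
    by (rule subdegreeI) (auto simp: carlitz_L_nonzero)
  moreover have "?g \<noteq> 0"
    using carlitz_log_tail_subdegree[of N, where 'a = 'a] by force
  ultimately have "?g dvd ?f"
    by (auto simp: fps_dvd_iff carlitz_log_tail_subdegree)
  moreover have "Abs_fps (\<lambda>n. truncated_cauchy_carlitz N n / carlitz_factorial n) = ?f / ?g"
    by (rule fps_ext)
       (simp add: truncated_cauchy_carlitz_def carlitz_log_partial_def carlitz_log_term_def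
          carlitz_factorial_nonzero)
  ultimately show ?thesis
    by (simp add: carlitz_log_partial_def carlitz_log_term_def)
qed

lemma stirling_carlitz1_gf:
  "Abs_fps (\<lambda>n. stirling_carlitz1 m n k / carlitz_factorial n) =
   ((carlitz_log - carlitz_log_partial m) ^ k / fps_const (carlitz_factorial k)
      :: 'a :: finite_field poly fract fps)"
  by (rule fps_ext) (simp add: stirling_carlitz1_def carlitz_factorial_nonzero)

end

theory Submission
  imports Defs
begin

text \<open>
  Removing the leading monomial \<open>c x ^ M\<close> from the tail of the Carlitz logarithm leaves a power
  series \<open>h\<close> with constant term 1, and \<open>CC\<^sub>N\<^sub>,\<^sub>n / \<Pi>(n)\<close> is the \<open>n\<close>-th coefficient of \<open>1 / h\<close>.
  Since \<open>(1 - h) ^ (n + 1)\<close> vanishes to order \<open>n + 1\<close>, dividing its binomial expansion by \<open>h\<close>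
  expresses that coefficient through those of \<open>h ^ k\<close> for \<open>k \<le> n\<close>.
\<close>

lemma fps_nth_inverse_binomial:
  fixes h :: "'b :: field fps"
  assumes h0: "fps_nth h 0 = 1" and "n \<ge> 1"
  shows "fps_nth (inverse h) n =
    (\<Sum>k=1..n. of_nat ((n + 1) choose (k + 1)) * (- 1) ^ k * fps_nth (h ^ k) n)"
proof -
  let ?b = "\<lambda>k. of_nat ((n + 1) choose k) :: 'b fps"
  have inv: "inverse h * h = 1"
    using h0 by (intro inverse_mult_eq_1) simp
  \<comment> \<open>Dividing by \<open>h\<close> lowers each exponent by one, which is why
    \<open>h ^ k\<close> ends up paired with the binomial coefficient at
    \<open>k + 1\<close>.\<close>
  have cancel: "inverse h * (?b (Suc k) * (- h) ^ Suc k) = - (?b (Suc k) * (- h) ^ k)" for k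
  proof -
    have "inverse h * (?b (Suc k) * (- h) ^ Suc k) = - (inverse h * h * (?b (Suc k) * (- h) ^ k))"
      by (simp add: mult_ac)
    thus ?thesis by (simp add: inv)
  qed
  have "(1 - h) ^ (n + 1) = (\<Sum>k\<le>Suc n. ?b k * (- h) ^ k)"
    using binomial_ring[of "- h" 1 "n + 1"] by simp
  also have "\<dots> = 1 + (\<Sum>k\<le>n. ?b (Suc k) * (- h) ^ Suc k)"
    by (subst sum.atMost_Suc_shift) simp
  finally have "inverse h * (1 - h) ^ (n + 1) =
      inverse h + (\<Sum>k\<le>n. inverse h * (?b (Suc k) * (- h) ^ Suc k))"
    by (simp only: distrib_left sum_distrib_left mult_1_right)
  hence expand:
    "inverse h * (1 - h) ^ (n + 1) = inverse h - (\<Sum>k\<le>n. ?b (Suc k) * (- h) ^ k)"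
    unfolding cancel by (simp add: sum_negf)
  have coeff: "fps_nth (?b (Suc k) * (- h) ^ k) n =
      of_nat ((n + 1) choose (k + 1)) * (- 1) ^ k * fps_nth (h ^ k) n" for k
  proof -
    have "?b (Suc k) * (- h) ^ k =
        fps_const (of_nat ((n + 1) choose (k + 1)) * (- 1) ^ k) * h ^ k"
      by (subst power_minus) (simp add: mult.assoc flip: fps_of_nat fps_const_mult
          fps_const_power fps_const_neg)
    thus ?thesis by (simp only: fps_mult_left_const_nth)
  qed
  \<comment> \<open>The series \<open>1 - h\<close> has zero constant term. All coefficients of its
    power up to index \<open>n\<close> vanish, hence so does the whole convolution with
    \<open>inverse h\<close> at \<open>n\<close>.\<close>
  have "fps_nth ((1 - h) ^ (n + 1)) i = 0" if "i \<le> n" for i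
    using that h0 by (intro startsby_zero_power_prefix[rule_format]) auto
  hence "fps_nth (inverse h * (1 - h) ^ (n + 1)) n = 0"
    unfolding fps_mult_nth[of "inverse h"] by (intro sum.neutral) simp
  hence "fps_nth (inverse h) n = (\<Sum>k\<le>n. fps_nth (?b (Suc k) * (- h) ^ k) n)"
    unfolding expand by (simp add: fps_sum_nth)
  \<comment> \<open>The term \<open>k = 0\<close> is a constant series, invisible at index
    \<open>n \<ge> 1\<close>.\<close>
  also have "\<dots> = (\<Sum>k=1..n. fps_nth (?b (Suc k) * (- h) ^ k) n)"
  proof (rule sum.mono_neutral_right)
    show "\<forall>k\<in>{..n} - {1..n}. fps_nth (?b (Suc k) * (- h) ^ k) n = 0"
    proof
      fix k assume "k \<in> {..n} - {1..n}"
      hence "k = 0" by auto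
      thus "fps_nth (?b (Suc k) * (- h) ^ k) n = 0"
        using \<open>n \<ge> 1\<close> by (simp flip: fps_of_nat)
    qed
  qed auto
  finally show ?thesis by (simp only: coeff)
qed

theorem theorem4:
  fixes N n :: nat
  assumes "N \<ge> 1" and "n \<ge> 1"
  shows "(truncated_cauchy_carlitz N n :: 'a :: finite_field poly fract) =
    carlitz_factorial n *
    (\<Sum>k=1..n. of_nat ((n + 1) choose (k + 1)) *
       ((- 1) ^ (N * k) * (- carlitz_L N) ^ k * carlitz_factorial k /
          carlitz_factorial (n + k * CARD('a) ^ N)) *
       stirling_carlitz1 N (n + k * CARD('a) ^ N) k)"
proof -
  define M where "M = CARD('a) ^ N"
  define L where "L = (carlitz_L N :: 'a poly fract)"
  \<comment> \<open>\<open>c\<close> is the leading coefficient of the tail \<open>g\<close>, so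
    \<open>h\<close> is \<open>g\<close> with its leading monomial divided out.\<close>
  define c where "c = (- 1) ^ N / L"
  define g where "g = (carlitz_log - carlitz_log_partial N :: 'a poly fract fps)"
  define h where "h = fps_const (inverse c) * fps_shift M g"
  have L: "L \<noteq> 0" and c: "c \<noteq> 0"
    by (simp_all add: L_def c_def carlitz_L_nonzero)
  have sub: "subdegree g = M"
    by (simp add: g_def M_def carlitz_log_tail_subdegree)
  hence g0: "g \<noteq> 0"
    by (auto simp: M_def)
  have "fps_nth g M = c"
    unfolding g_def M_def carlitz_log_tail_nth c_def L_def
    by (auto simp: carlitz_log_nth_power(1))
  hence h0: "fps_nth h 0 = 1"
    using c by (simp add: h_def)
  \<comment> \<open>The shift loses no coefficient because \<open>g\<close> has subdegree exactly
    \<open>M\<close>.\<close>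
  have g_eq: "g = fps_const c * fps_X ^ M * h"
  proof -
    have "fps_const c * fps_X ^ M * h = fps_const (c * inverse c) * (fps_shift M g * fps_X ^ M)"
      by (simp add: h_def mult_ac flip: fps_const_mult)
    also have "\<dots> = g"
      using c sub by (simp add: fps_shift_times_fps_X_power)
    finally show ?thesis by simp
  qed
  have "fps_const c * fps_X ^ M = g * inverse h"
  proof -
    have "h * inverse h = 1"
      using h0 by (intro inverse_mult_eq_1') simp
    thus ?thesis by (simp add: g_eq mult.assoc)
  qed
  hence "fps_const c * fps_X ^ M / g = inverse h"
    using g0 by simp
  hence lhs: "truncated_cauchy_carlitz N n = carlitz_factorial n * fps_nth (inverse h) n"
    by (simp add: truncated_cauchy_carlitz_def g_def c_def L_def M_def
        carlitz_log_partial_def carlitz_log_term_def)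
  \<comment> \<open>The factor \<open>fps_X ^ (k * M)\<close> in \<open>g ^ k\<close> accounts for
    the upper index \<open>n + k * M\<close> of the Stirling-Carlitz numbers.\<close>
  have tail_power: "fps_nth (g ^ k) (n + k * M) = c ^ k * fps_nth (h ^ k) n" for k
  proof -
    have "g ^ k = fps_const (c ^ k) * (fps_X ^ (k * M) * h ^ k)"
      by (simp add: g_eq power_mult_distrib fps_const_power mult.assoc mult.commute[of k]
          flip: power_mult)
    thus ?thesis by (simp add: fps_X_power_mult_nth)
  qed
  \<comment> \<open>The case \<open>k = 1\<close> suffices: the two factors \<open>(- 1) ^ N\<close>
    cancel, as do \<open>L\<close> and its inverse in \<open>c\<close>, leaving
    \<open>- 1\<close>.\<close>
  have sign: "(- 1) ^ (N * k) * (- L) ^ k * c ^ k = (- 1) ^ k" for k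
  proof -
    have "(- 1) ^ N * (- L) * c = - 1"
      using L by (simp add: c_def flip: power_add mult_2)
    thus ?thesis
      by (metis power_mult power_mult_distrib)
  qed
  have div_const: "fps_nth (p / fps_const (carlitz_factorial k)) m =
      fps_nth p m / carlitz_factorial k" for p :: "'a poly fract fps" and k m
    by (simp add: divide_inverse mult.commute carlitz_factorial_nonzero)
  \<comment> \<open>Both Carlitz factorials cancel against those in the definition of
    \<open>stirling_carlitz1\<close>.\<close>
  have stirling: "(- 1) ^ (N * k) * (- L) ^ k * carlitz_factorial k /
        carlitz_factorial (n + k * M) * stirling_carlitz1 N (n + k * M) k =
      (- 1) ^ k * fps_nth (h ^ k) n" for k
  proof -
    have "stirling_carlitz1 N (n + k * M) k =
        carlitz_factorial (n + k * M) * (c ^ k * fps_nth (h ^ k) n / carlitz_factorial k)"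
      by (simp only: stirling_carlitz1_def div_const tail_power flip: g_def)
    hence "(- 1) ^ (N * k) * (- L) ^ k * carlitz_factorial k /
        carlitz_factorial (n + k * M) * stirling_carlitz1 N (n + k * M) k =
        ((- 1) ^ (N * k) * (- L) ^ k * c ^ k) * fps_nth (h ^ k) n"
      by (simp add: carlitz_factorial_nonzero)
    thus ?thesis by (simp only: sign)
  qed
  show ?thesis
    unfolding lhs fps_nth_inverse_binomial[OF h0 \<open>n \<ge> 1\<close>]
    by (simp only: mult.assoc stirling[unfolded mult.assoc] flip: M_def L_def)
qed

end
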